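(* The full subcategory $\overline{\mathbf{QGeod}}\subset\overline{\mathbf{CLip}}$ of quasigeodesic spaces is closed under all colimits: if $\mathsf J$ is a small category, $D\colon\mathsf J\to\overline{\mathbf{CLip}}$ is a diagram all of whose objects $D_j$ are quasigeodesic, and $X$ is a colimit of $D$ in $\overline{\mathbf{CLip}}$, then $X$ is quasigeodesic.
   Context: Metric spaces are extended: distances may be $\infty$. Maps $f,f'\colon X\to Y$ are close if $\sup_{x} d_Y(fx,f'x)<\infty$. A map $f\colon X\to Y$ is coarsely Lipschitz if there are $a,b\ge 0$ with $d_Y(fx,fx')\le a\,d_X(x,x')+b$ for all $x,x'$ with $d_X(x,x')<\infty$. The category $\overline{\mathbf{CLip}}$ has metric spaces as objects and closeness classes of coarsely Lipschitz maps as morphisms; its isomorphisms are the closeness classes of quasi-isometries. A metric space is quasigeodesic if it is quasi-isometric to a graph with its combinatorial metric (graphs may be disconnected, with points in different components at distance $\infty$). No uniformity of quasigeodesicity constants or of the coarsely Lipschitz constants in the diagram is assumed. *)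

theory Defs
  imports "HOL-Library.Extended_Nonnegative_Real" "HOL-Library.FuncSet"
begin

section \<open>Categories, diagrams and colimits\<close>

record ('o, 'm) category =
  Ob :: "'o set"
  Arr :: "'m set"
  Dom :: "'m \<Rightarrow> 'o"
  Cod :: "'m \<Rightarrow> 'o"
  Id :: "'o \<Rightarrow> 'm"
  Comp :: "'m \<Rightarrow> 'm \<Rightarrow> 'm"

definition hom :: "('o, 'm) category \<Rightarrow> 'o \<Rightarrow> 'o \<Rightarrow> 'm set" where
  "hom C a b = {f \<in> Arr C. Dom C f = a \<and> Cod C f = b}"

text \<open>\<open>Comp C g f\<close> is "g after f"; it is only meaningful when \<open>Cod C f = Dom C g\<close>.\<close>

locale category =
  fixes C :: "('o, 'm) category"
  assumes Dom_in_Ob: "f \<in> Arr C \<Longrightarrow> Dom C f \<in> Ob C"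
    and Cod_in_Ob: "f \<in> Arr C \<Longrightarrow> Cod C f \<in> Ob C"
    and Id_in_hom: "a \<in> Ob C \<Longrightarrow> Id C a \<in> hom C a a"
    and Comp_in_hom: "f \<in> hom C a b \<Longrightarrow> g \<in> hom C b c \<Longrightarrow> Comp C g f \<in> hom C a c"
    and Id_Comp: "f \<in> hom C a b \<Longrightarrow> Comp C (Id C b) f = f"
    and Comp_Id: "f \<in> hom C a b \<Longrightarrow> Comp C f (Id C a) = f"
    and Comp_assoc: "f \<in> hom C a b \<Longrightarrow> g \<in> hom C b c \<Longrightarrow> h \<in> hom C c d \<Longrightarrow>
      Comp C (Comp C h g) f = Comp C h (Comp C g f)"

locale diagram = J: category J + C: category C
  for J :: "('j, 'u) category" and C :: "('o, 'm) category" +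
  fixes D :: "'j \<Rightarrow> 'o" and D' :: "'u \<Rightarrow> 'm"
  assumes map_Ob: "j \<in> Ob J \<Longrightarrow> D j \<in> Ob C"
    and map_hom: "u \<in> hom J i j \<Longrightarrow> D' u \<in> hom C (D i) (D j)"
    and map_Id: "j \<in> Ob J \<Longrightarrow> D' (Id J j) = Id C (D j)"
    and map_Comp: "u \<in> hom J i j \<Longrightarrow> v \<in> hom J j k \<Longrightarrow>
      D' (Comp J v u) = Comp C (D' v) (D' u)"

definition is_cocone ::
  "('j, 'u) category \<Rightarrow> ('o, 'm) category \<Rightarrow> ('j \<Rightarrow> 'o) \<Rightarrow> ('u \<Rightarrow> 'm) \<Rightarrow> 'o \<Rightarrow> ('j \<Rightarrow> 'm) \<Rightarrow> bool"
  where "is_cocone J C D D' X \<iota> \<longleftrightarrow>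
    X \<in> Ob C \<and>
    (\<forall>j\<in>Ob J. \<iota> j \<in> hom C (D j) X) \<and>
    (\<forall>i\<in>Ob J. \<forall>j\<in>Ob J. \<forall>u\<in>hom J i j. Comp C (\<iota> j) (D' u) = \<iota> i)"

definition is_colimit ::
  "('j, 'u) category \<Rightarrow> ('o, 'm) category \<Rightarrow> ('j \<Rightarrow> 'o) \<Rightarrow> ('u \<Rightarrow> 'm) \<Rightarrow> 'o \<Rightarrow> ('j \<Rightarrow> 'm) \<Rightarrow> bool"
  where "is_colimit J C D D' X \<iota> \<longleftrightarrow>
    is_cocone J C D D' X \<iota> \<and>
    (\<forall>Y \<kappa>. is_cocone J C D D' Y \<kappa> \<longrightarrow>
      (\<exists>!h. h \<in> hom C X Y \<and> (\<forall>j\<in>Ob J. Comp C h (\<iota> j) = \<kappa> j)))"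


section \<open>Extended metric spaces and coarsely Lipschitz maps\<close>

record 'a emspace =
  pts :: "'a set"
  edist :: "'a \<Rightarrow> 'a \<Rightarrow> ennreal"

definition extended_metric_space :: "'a emspace \<Rightarrow> bool" where
  "extended_metric_space X \<longleftrightarrow>
    (\<forall>x\<in>pts X. \<forall>y\<in>pts X. edist X x y = 0 \<longleftrightarrow> x = y) \<and>
    (\<forall>x\<in>pts X. \<forall>y\<in>pts X. edist X x y = edist X y x) \<and>
    (\<forall>x\<in>pts X. \<forall>y\<in>pts X. \<forall>z\<in>pts X. edist X x z \<le> edist X x y + edist X y z)"

definition coarsely_lipschitz :: "'a emspace \<Rightarrow> 'b emspace \<Rightarrow> ('a \<Rightarrow> 'b) \<Rightarrow> bool" where
  "coarsely_lipschitz X Y f \<longleftrightarrow>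
    f \<in> pts X \<rightarrow> pts Y \<and>
    (\<exists>a b :: real. a \<ge> 0 \<and> b \<ge> 0 \<and>
      (\<forall>x\<in>pts X. \<forall>x'\<in>pts X. edist X x x' < \<infinity> \<longrightarrow>
        edist Y (f x) (f x') \<le> ennreal a * edist X x x' + ennreal b))"

definition close_maps :: "'a emspace \<Rightarrow> 'b emspace \<Rightarrow> ('a \<Rightarrow> 'b) \<Rightarrow> ('a \<Rightarrow> 'b) \<Rightarrow> bool" where
  "close_maps X Y f f' \<longleftrightarrow> (SUP x\<in>pts X. edist Y (f x) (f' x)) < \<infinity>"

definition clip_maps :: "'a emspace \<Rightarrow> 'b emspace \<Rightarrow> ('a \<Rightarrow> 'b) set" where
  "clip_maps X Y = {f. coarsely_lipschitz X Y f}"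

text \<open>Maps are total functions on the type of points. Their values outside \<open>pts X\<close> do not
  matter: two maps that agree on \<open>pts X\<close> are close, hence have the same closeness class.\<close>

definition closeness :: "'a emspace \<Rightarrow> 'b emspace \<Rightarrow> (('a \<Rightarrow> 'b) \<times> ('a \<Rightarrow> 'b)) set" where
  "closeness X Y = {(f, f'). f \<in> clip_maps X Y \<and> f' \<in> clip_maps X Y \<and> close_maps X Y f f'}"

text \<open>The category of extended metric spaces with points in the type \<open>'a\<close> (the universe) and
  closeness classes of coarsely Lipschitz maps. A colimit in this category is tested against
  spaces with points in \<open>'a\<close> only, so being one is implied by the universal property with respect
  to all spaces. An arrow is a triple of domain, codomain and
  closeness class. The class of the composite is written as the closeness saturation of all
  composites of representatives; \<open>closeness_comp\<close> below shows that it is the class of any one of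
  them.\<close>

definition CLip ::
  "('a emspace, 'a emspace \<times> 'a emspace \<times> ('a \<Rightarrow> 'a) set) category" where
  "CLip = \<lparr>
    Ob = {X. extended_metric_space X},
    Arr = {(X, Y, F). extended_metric_space X \<and> extended_metric_space Y \<and>
             F \<in> clip_maps X Y // closeness X Y},
    Dom = (\<lambda>(X, Y, F). X),
    Cod = (\<lambda>(X, Y, F). Y),
    Id = (\<lambda>X. (X, X, closeness X X `` {id})),
    Comp = (\<lambda>(Y, Z, G) (X, Y', F). (X, Z, closeness X Z `` {g \<circ> f |g f. g \<in> G \<and> f \<in> F}))\<rparr>"

definition quasi_isometry :: "'a emspace \<Rightarrow> 'b emspace \<Rightarrow> ('a \<Rightarrow> 'b) \<Rightarrow> bool" where
  "quasi_isometry X Y f \<longleftrightarrow> coarsely_lipschitz X Y f \<and>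
    (\<exists>g. coarsely_lipschitz Y X g \<and> close_maps X X (g \<circ> f) id \<and> close_maps Y Y (f \<circ> g) id)"


section \<open>Graphs and quasigeodesic spaces\<close>

text \<open>Edges form a symmetric relation. Loops are permitted; neither they nor multiple edges
  would affect the combinatorial metric.\<close>

definition graph :: "'v set \<Rightarrow> ('v \<times> 'v) set \<Rightarrow> bool" where
  "graph V E \<longleftrightarrow> E \<subseteq> V \<times> V \<and> sym E"

text \<open>\<open>(u, v) \<in> E ^^ n\<close> says that there is a walk of length \<open>n\<close> from \<open>u\<close> to \<open>v\<close>; the infimum of
  the empty set is \<open>\<infinity>\<close>.\<close>

definition graph_space :: "'v set \<Rightarrow> ('v \<times> 'v) set \<Rightarrow> 'v emspace" where
  "graph_space V E =
    \<lparr>pts = V, edist = (\<lambda>u v. INF n\<in>{n. (u, v) \<in> E ^^ n}. (of_nat n :: ennreal))\<rparr>"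

text \<open>It is no restriction to take the vertices in the type of points of \<open>X\<close>: a space
  quasi-isometric to some graph is quasi-isometric to a graph whose vertices are its own points
  (join points at distance at most \<open>r\<close>, for \<open>r\<close> large).\<close>

definition quasigeodesic :: "'a emspace \<Rightarrow> bool" where
  "quasigeodesic X \<longleftrightarrow> extended_metric_space X \<and>
    (\<exists>(V :: 'a set) E f. graph V E \<and> quasi_isometry X (graph_space V E) f)"


section \<open>Well-definedness\<close>

lemma close_maps_iff:
  "close_maps X Y f f' \<longleftrightarrow> (\<exists>c::real. c \<ge> 0 \<and> (\<forall>x\<in>pts X. edist Y (f x) (f' x) \<le> ennreal c))"
proof
  assume "close_maps X Y f f'"
  then have "(SUP x\<in>pts X. edist Y (f x) (f' x)) < top"
    by (simp add: close_maps_def)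
  then obtain c where c: "c \<ge> 0" "(SUP x\<in>pts X. edist Y (f x) (f' x)) = ennreal c"
    by (cases "SUP x\<in>pts X. edist Y (f x) (f' x)") auto
  then show "\<exists>c::real. c \<ge> 0 \<and> (\<forall>x\<in>pts X. edist Y (f x) (f' x) \<le> ennreal c)"
    by (metis SUP_upper)
next
  assume "\<exists>c::real. c \<ge> 0 \<and> (\<forall>x\<in>pts X. edist Y (f x) (f' x) \<le> ennreal c)"
  then obtain c where "\<forall>x\<in>pts X. edist Y (f x) (f' x) \<le> ennreal c" by blast
  then have "(SUP x\<in>pts X. edist Y (f x) (f' x)) \<le> ennreal c"
    by (intro SUP_least) auto
  then show "close_maps X Y f f'"
    unfolding close_maps_def by (simp add: order_le_less_trans)
qed

lemma close_maps_refl: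
  assumes "extended_metric_space Y" "f \<in> pts X \<rightarrow> pts Y"
  shows "close_maps X Y f f"
  unfolding close_maps_iff using assms
  by (intro exI[of _ 0]) (auto simp: extended_metric_space_def Pi_iff)

lemma close_maps_sym:
  assumes "extended_metric_space Y" "f \<in> pts X \<rightarrow> pts Y" "f' \<in> pts X \<rightarrow> pts Y"
    "close_maps X Y f f'"
  shows "close_maps X Y f' f"
proof -
  have "edist Y (f' x) (f x) = edist Y (f x) (f' x)" if "x \<in> pts X" for x
    using assms(1-3) that by (auto simp: extended_metric_space_def Pi_iff)
  then show ?thesis using assms(4) by (simp add: close_maps_def)
qed

lemma close_maps_trans:
  assumes Y: "extended_metric_space Y"
    and "f \<in> pts X \<rightarrow> pts Y" "g \<in> pts X \<rightarrow> pts Y" "h \<in> pts X \<rightarrow> pts Y"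
    and fg: "close_maps X Y f g" and gh: "close_maps X Y g h"
  shows "close_maps X Y f h"
proof -
  obtain c where c: "c \<ge> 0" "\<forall>x\<in>pts X. edist Y (f x) (g x) \<le> ennreal c"
    using fg unfolding close_maps_iff by blast
  obtain d where d: "d \<ge> 0" "\<forall>x\<in>pts X. edist Y (g x) (h x) \<le> ennreal d"
    using gh unfolding close_maps_iff by blast
  have "edist Y (f x) (h x) \<le> ennreal (c + d)" if "x \<in> pts X" for x
  proof -
    have "edist Y (f x) (h x) \<le> edist Y (f x) (g x) + edist Y (g x) (h x)"
      using Y assms(2-4) that by (auto simp: extended_metric_space_def Pi_iff)
    also have "\<dots> \<le> ennreal c + ennreal d"
      using c d that by (intro add_mono) auto
    finally show ?thesis using c d by simp
  qed
  then show ?thesis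
    unfolding close_maps_iff using c d by (intro exI[of _ "c + d"]) auto
qed

lemma equiv_closeness:
  assumes "extended_metric_space Y"
  shows "equiv (clip_maps X Y) (closeness X Y)"
proof (rule equivI)
  show "closeness X Y \<subseteq> clip_maps X Y \<times> clip_maps X Y"
    by (auto simp: closeness_def)
  show "refl_on (clip_maps X Y) (closeness X Y)"
    using assms by (auto simp: refl_on_def closeness_def clip_maps_def coarsely_lipschitz_def
        intro: close_maps_refl)
  show "sym (closeness X Y)"
  proof (rule symI)
    fix f g assume "(f, g) \<in> closeness X Y"
    then show "(g, f) \<in> closeness X Y"
      using close_maps_sym[OF assms, of f X g]
      by (simp add: closeness_def clip_maps_def coarsely_lipschitz_def)
  qed
  show "trans (closeness X Y)"
  proof (rule transI)
    fix f g h assume "(f, g) \<in> closeness X Y" "(g, h) \<in> closeness X Y"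
    then show "(f, h) \<in> closeness X Y"
      using close_maps_trans[OF assms, of f X g h]
      by (simp add: closeness_def clip_maps_def coarsely_lipschitz_def)
  qed
qed

lemma id_clip: "id \<in> clip_maps X X"
  unfolding clip_maps_def coarsely_lipschitz_def
  by (intro CollectI conjI exI[of _ "1::real"] exI[of _ "0::real"]) auto

lemma comp_clip:
  assumes "f \<in> clip_maps X Y" "g \<in> clip_maps Y Z"
  shows "g \<circ> f \<in> clip_maps X Z"
proof -
  obtain a b where f: "f \<in> pts X \<rightarrow> pts Y" "a \<ge> 0" "b \<ge> 0"
    "\<And>x x'. x \<in> pts X \<Longrightarrow> x' \<in> pts X \<Longrightarrow> edist X x x' < \<infinity> \<Longrightarrow>
       edist Y (f x) (f x') \<le> ennreal a * edist X x x' + ennreal b"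
    using assms(1) unfolding clip_maps_def coarsely_lipschitz_def by auto
  obtain a' b' where g: "g \<in> pts Y \<rightarrow> pts Z" "a' \<ge> 0" "b' \<ge> 0"
    "\<And>x x'. x \<in> pts Y \<Longrightarrow> x' \<in> pts Y \<Longrightarrow> edist Y x x' < \<infinity> \<Longrightarrow>
       edist Z (g x) (g x') \<le> ennreal a' * edist Y x x' + ennreal b'"
    using assms(2) unfolding clip_maps_def coarsely_lipschitz_def by auto
  have "edist Z (g (f x)) (g (f x')) \<le> ennreal (a' * a) * edist X x x' + ennreal (a' * b + b')"
    if x: "x \<in> pts X" "x' \<in> pts X" and fin: "edist X x x' < \<infinity>" for x x'
  proof -
    have le: "edist Y (f x) (f x') \<le> ennreal a * edist X x x' + ennreal b"
      using f(4) x fin by blast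
    moreover have "ennreal a * edist X x x' + ennreal b < \<infinity>"
      using fin by (simp add: ennreal_mult_less_top)
    ultimately have "edist Y (f x) (f x') < \<infinity>" by (rule order_le_less_trans)
    then have "edist Z (g (f x)) (g (f x')) \<le> ennreal a' * edist Y (f x) (f x') + ennreal b'"
      using f(1) g(4) x by blast
    also have "\<dots> \<le> ennreal a' * (ennreal a * edist X x x' + ennreal b) + ennreal b'"
      using le by (intro add_right_mono mult_left_mono) auto
    also have "\<dots> = ennreal (a' * a) * edist X x x' + ennreal (a' * b + b')"
      using f(2,3) g(2,3) by (simp add: ennreal_mult ennreal_plus distrib_left mult.assoc add.assoc)
    finally show ?thesis .
  qed
  moreover have "g \<circ> f \<in> pts X \<rightarrow> pts Z" using f(1) g(1) by auto
  moreover have "a' * a \<ge> 0" "a' * b + b' \<ge> 0" using f g by auto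
  ultimately show ?thesis
    unfolding clip_maps_def coarsely_lipschitz_def comp_def by blast
qed

lemma closeness_comp_cong:
  assumes Z: "extended_metric_space Z"
    and f: "(f, f') \<in> closeness X Y" and g: "(g, g') \<in> closeness Y Z"
  shows "(g \<circ> f, g' \<circ> f') \<in> closeness X Z"
proof -
  have fm: "f \<in> clip_maps X Y" "f' \<in> clip_maps X Y" "close_maps X Y f f'"
    and gm: "g \<in> clip_maps Y Z" "g' \<in> clip_maps Y Z" "close_maps Y Z g g'"
    using f g by (auto simp: closeness_def)
  have maps: "g \<circ> f \<in> clip_maps X Z" "g \<circ> f' \<in> clip_maps X Z" "g' \<circ> f' \<in> clip_maps X Z"
    using fm gm by (auto intro: comp_clip)
  have pi: "f \<in> pts X \<rightarrow> pts Y" "f' \<in> pts X \<rightarrow> pts Y"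
    using fm by (auto simp: clip_maps_def coarsely_lipschitz_def)
  have "close_maps X Z (g \<circ> f) (g \<circ> f')"
  proof -
    obtain c where c: "c \<ge> 0" "\<And>x. x \<in> pts X \<Longrightarrow> edist Y (f x) (f' x) \<le> ennreal c"
      using fm(3) unfolding close_maps_iff by blast
    obtain a b where ab: "a \<ge> 0" "b \<ge> 0"
      "\<And>x x'. x \<in> pts Y \<Longrightarrow> x' \<in> pts Y \<Longrightarrow> edist Y x x' < \<infinity> \<Longrightarrow>
         edist Z (g x) (g x') \<le> ennreal a * edist Y x x' + ennreal b"
      using gm(1) unfolding clip_maps_def coarsely_lipschitz_def by auto
    have "edist Z (g (f x)) (g (f' x)) \<le> ennreal (a * c + b)" if x: "x \<in> pts X" for x
    proof -
      have "edist Y (f x) (f' x) < \<infinity>"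
        using c(2)[OF x] by (simp add: order_le_less_trans)
      then have "edist Z (g (f x)) (g (f' x)) \<le> ennreal a * edist Y (f x) (f' x) + ennreal b"
        using ab(3) pi x by blast
      also have "\<dots> \<le> ennreal a * ennreal c + ennreal b"
        using c(2)[OF x] by (intro add_right_mono mult_left_mono) auto
      also have "\<dots> = ennreal (a * c + b)"
        using ab c by (simp add: ennreal_mult ennreal_plus)
      finally show ?thesis .
    qed
    then show ?thesis
      unfolding close_maps_iff using ab c by (intro exI[of _ "a * c + b"]) auto
  qed
  moreover have "close_maps X Z (g \<circ> f') (g' \<circ> f')"
    using gm(3) pi(2) unfolding close_maps_iff by (auto simp: Pi_iff)
  ultimately have "close_maps X Z (g \<circ> f) (g' \<circ> f')"
    using maps close_maps_trans[OF Z, of "g \<circ> f" X "g \<circ> f'" "g' \<circ> f'"]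
    by (simp add: clip_maps_def coarsely_lipschitz_def)
  then show ?thesis using maps by (simp add: closeness_def)
qed

lemma closeness_comp:
  assumes Y: "extended_metric_space Y" and Z: "extended_metric_space Z"
    and f: "f \<in> clip_maps X Y" and g: "g \<in> clip_maps Y Z"
  shows "closeness X Z `` {g' \<circ> f' |g' f'. g' \<in> closeness Y Z `` {g} \<and> f' \<in> closeness X Y `` {f}}
    = closeness X Z `` {g \<circ> f}" (is "?L = ?R")
proof
  note eY = equiv_closeness[OF Y] and eZ = equiv_closeness[OF Z]
  have "(f, f) \<in> closeness X Y" "(g, g) \<in> closeness Y Z"
    using f g eY[of X] eZ[of Y] by (auto simp: equiv_def refl_on_def)
  then show "?R \<subseteq> ?L" by blast
  show "?L \<subseteq> ?R"
  proof
    fix h assume "h \<in> ?L"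
    then obtain g' f' where "(g, g') \<in> closeness Y Z" "(f, f') \<in> closeness X Y"
      and h: "(g' \<circ> f', h) \<in> closeness X Z" by blast
    then have "(g \<circ> f, g' \<circ> f') \<in> closeness X Z" by (blast intro: closeness_comp_cong[OF Z])
    with h eZ[of X] show "h \<in> ?R" by (auto simp: equiv_def dest: transD)
  qed
qed

lemma hom_CLip:
  "\<phi> \<in> hom CLip X Y \<longleftrightarrow> extended_metric_space X \<and> extended_metric_space Y \<and>
    (\<exists>f. coarsely_lipschitz X Y f \<and> \<phi> = (X, Y, closeness X Y `` {f}))"
  by (cases \<phi>) (auto simp: hom_def CLip_def quotient_def clip_maps_def)

lemma Comp_CLip:
  assumes "extended_metric_space Y" "extended_metric_space Z"
    "coarsely_lipschitz X Y f" "coarsely_lipschitz Y Z g"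
  shows "Comp CLip (Y, Z, closeness Y Z `` {g}) (X, Y, closeness X Y `` {f})
    = (X, Z, closeness X Z `` {g \<circ> f})"
  using closeness_comp[OF assms(1,2), of f X g] assms(3,4) by (simp add: CLip_def clip_maps_def)

lemma coarsely_lipschitz_id: "coarsely_lipschitz X X id"
  using id_clip[of X] by (simp add: clip_maps_def)

lemma coarsely_lipschitz_comp:
  "coarsely_lipschitz X Y f \<Longrightarrow> coarsely_lipschitz Y Z g \<Longrightarrow> coarsely_lipschitz X Z (g \<circ> f)"
  using comp_clip[of f X Y g Z] by (simp add: clip_maps_def)

lemma Id_CLip: "Id CLip X = (X, X, closeness X X `` {id})"
  by (simp add: CLip_def)

lemma category_CLip: "category CLip"
proof
  fix X assume "X \<in> Ob CLip"
  then show "Id CLip X \<in> hom CLip X X"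
    unfolding hom_CLip Id_CLip using coarsely_lipschitz_id by (auto simp: CLip_def)
next
  fix f assume "f \<in> Arr CLip"
  then show "Dom CLip f \<in> Ob CLip" "Cod CLip f \<in> Ob CLip"
    by (auto simp: CLip_def)
next
  fix f g X Y Z assume "f \<in> hom CLip X Y" "g \<in> hom CLip Y Z"
  then show "Comp CLip g f \<in> hom CLip X Z"
    unfolding hom_CLip by (auto simp: Comp_CLip intro: coarsely_lipschitz_comp)
next
  fix f X Y assume "f \<in> hom CLip X Y"
  then show "Comp CLip (Id CLip Y) f = f" "Comp CLip f (Id CLip X) = f"
    unfolding hom_CLip by (auto simp: Comp_CLip Id_CLip coarsely_lipschitz_id)
next
  fix f g h W X Y Z assume "f \<in> hom CLip W X" "g \<in> hom CLip X Y" "h \<in> hom CLip Y Z"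
  then show "Comp CLip (Comp CLip h g) f = Comp CLip h (Comp CLip g f)"
    unfolding hom_CLip by (auto simp: Comp_CLip coarsely_lipschitz_comp comp_assoc)
qed

lemma extended_metric_space_graph_space:
  assumes "graph V E"
  shows "extended_metric_space (graph_space V E)"
proof -
  let ?d = "\<lambda>u v. INF n\<in>{n. (u, v) \<in> E ^^ n}. (of_nat n :: ennreal)"
  have sym_pow: "(v, u) \<in> E ^^ n" if "(u, v) \<in> E ^^ n" for u v n
    using that
  proof (induction n arbitrary: u v)
    case (Suc n)
    then obtain w where "(u, w) \<in> E ^^ n" "(w, v) \<in> E" by auto
    then show ?case
      using Suc.IH assms by (metis graph_def relpow_Suc_I2 symD)
  qed simp
  have zero: "?d u v = 0 \<longleftrightarrow> u = v" for u v
  proof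
    assume d: "?d u v = 0"
    show "u = v"
    proof (rule ccontr)
      assume "u \<noteq> v"
      then have "1 \<le> ?d u v"
        by (intro INF_greatest) (auto simp: Suc_le_eq intro!: Nat.gr0I)
      with d show False by simp
    qed
  next
    assume "u = v"
    then have "?d u v \<le> of_nat 0" by (intro INF_lower) auto
    then show "?d u v = 0" by simp
  qed
  have symd: "?d u v = ?d v u" for u v
    by (rule INF_cong) (auto intro: sym_pow)
  have tri: "?d u w \<le> ?d u v + ?d v w" for u v w
  proof (cases "{n. (u, v) \<in> E ^^ n} = {} \<or> {n. (v, w) \<in> E ^^ n} = {}")
    case True
    then show ?thesis by (auto simp del: Collect_empty_eq)
  next
    case False
    define m where "m = (LEAST n. (u, v) \<in> E ^^ n)"
    define n where "n = (LEAST n. (v, w) \<in> E ^^ n)"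
    have m: "(u, v) \<in> E ^^ m" and n: "(v, w) \<in> E ^^ n"
      using False unfolding m_def n_def by (auto intro: LeastI)
    have "of_nat m \<le> ?d u v" "of_nat n \<le> ?d v w"
      unfolding m_def n_def by (auto intro!: INF_greatest Least_le)
    moreover have "(u, w) \<in> E ^^ (m + n)" using m n by (auto simp: relpow_add)
    then have "?d u w \<le> of_nat (m + n)" by (intro INF_lower) auto
    ultimately show ?thesis by (auto intro: order_trans add_mono)
  qed
  show ?thesis
    unfolding extended_metric_space_def graph_space_def emspace.simps
    by (intro conjI ballI zero symd tri)
qed

end

theory Submission
  imports Defs
begin

text \<open>
  For a weight function \<open>w\<close> on the natural numbers let \<open>X\<^sub>w\<close> be the set \<open>X\<close> with the metric in which
  a chain of points costs the sum of the weights \<open>w k\<close> of its steps, a step of length at most \<open>k\<close>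
  having weight \<open>w k\<close>. If \<open>w k \<ge> max 1 k\<close>, the identity \<open>X\<^sub>w \<rightarrow> X\<close> is Lipschitz, maps into \<open>X\<close> that
  are close remain close in \<open>X\<^sub>w\<close>, and a coarsely Lipschitz map from a graph to \<open>X\<close> is coarsely
  Lipschitz into \<open>X\<^sub>w\<close>, since all edges have images of length at most some fixed \<open>k\<close>. Hence a colimit
  cocone of quasigeodesic spaces on \<open>X\<close> lifts to \<open>X\<^sub>w\<close>, whatever \<open>w\<close> is, and the universal property
  forces the identity \<open>X \<rightarrow> X\<^sub>w\<close> to be coarsely Lipschitz.

  If \<open>X\<close> is not quasigeodesic, there is for each \<open>n\<close> a pair \<open>p\<^sub>n, q\<^sub>n\<close> at finite distance \<open>d\<^sub>n\<close> that is
  not joined by a chain of at most \<open>n d\<^sub>n + n\<close> steps of length at most \<open>n\<close>. Taking \<open>w k \<ge> n d\<^sub>n + n\<close> for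
  all \<open>k \<ge> n\<close>, every chain from \<open>p\<^sub>n\<close> to \<open>q\<^sub>n\<close> costs at least \<open>n d\<^sub>n + n\<close>, for all \<open>n\<close>: the identity
  \<open>X \<rightarrow> X\<^sub>w\<close> is not coarsely Lipschitz.
\<close>

section \<open>Attained infima, and closeness of representatives\<close>

text \<open>Walk lengths and chain costs are natural numbers, so every finite distance in a graph or
  in a chain space is realised by an actual walk or chain.\<close>

lemma INF_of_nat_attained:
  assumes "(INF n\<in>S. (of_nat n :: ennreal)) < \<infinity>"
  obtains n where "n \<in> S" "(INF n\<in>S. (of_nat n :: ennreal)) = of_nat n"
proof -
  have "S \<noteq> {}" using assms by auto
  then have L: "(LEAST n. n \<in> S) \<in> S" by (auto intro: LeastI)
  have "(INF n\<in>S. (of_nat n :: ennreal)) = of_nat (LEAST n. n \<in> S)"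
    by (intro antisym INF_lower L INF_greatest) (auto intro: Least_le)
  with L show thesis using that by blast
qed

lemma ennreal_le_of_nat: obtains k where "ennreal c \<le> of_nat k"
  using real_arch_simple[of c] by (metis ennreal_leI ennreal_of_nat_eq_real_of_nat)

lemma closeness_class_eq_iff:
  assumes "extended_metric_space Y" "coarsely_lipschitz X Y f" "coarsely_lipschitz X Y g"
  shows "closeness X Y `` {f} = closeness X Y `` {g} \<longleftrightarrow> close_maps X Y f g"
  using eq_equiv_class_iff[OF equiv_closeness[OF assms(1), of X], of f g] assms(2,3)
  by (auto simp: clip_maps_def closeness_def)

lemma close_maps_comp:
  assumes "extended_metric_space Z" "coarsely_lipschitz X Y f" "coarsely_lipschitz X Y f'"
    "coarsely_lipschitz Y Z g" "close_maps X Y f f'"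
  shows "close_maps X Z (g \<circ> f) (g \<circ> f')"
proof -
  have "g \<in> pts Y \<rightarrow> pts Z" using assms(4) by (simp add: coarsely_lipschitz_def)
  then have "close_maps Y Z g g" by (rule close_maps_refl[OF assms(1)])
  then show ?thesis
    using closeness_comp_cong[OF assms(1), of f f' X Y g g] assms(2-5)
    by (simp add: closeness_def clip_maps_def)
qed

text \<open>Replacing \<open>f\<close> by \<open>f'\<close> costs at most \<open>c\<close> at each
  of the two endpoints, whence the additive constant \<open>b + 2 * c\<close>.\<close>

lemma coarsely_lipschitz_close:
  assumes Y: "extended_metric_space Y" and f: "coarsely_lipschitz X Y f"
    and f': "f' \<in> pts X \<rightarrow> pts Y" and close: "close_maps X Y f f'"
  shows "coarsely_lipschitz X Y f'"
proof -
  obtain a b where ab: "a \<ge> 0" "b \<ge> 0" and f_pts: "f \<in> pts X \<rightarrow> pts Y"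
    and lip: "\<And>x x'. x \<in> pts X \<Longrightarrow> x' \<in> pts X \<Longrightarrow> edist X x x' < \<infinity> \<Longrightarrow>
      edist Y (f x) (f x') \<le> ennreal a * edist X x x' + ennreal b"
    using f unfolding coarsely_lipschitz_def by auto
  obtain c where c: "c \<ge> 0" "\<And>x. x \<in> pts X \<Longrightarrow> edist Y (f x) (f' x) \<le> ennreal c"
    using close unfolding close_maps_iff by blast
  have "edist Y (f' x) (f' x') \<le> ennreal a * edist X x x' + ennreal (b + 2 * c)"
    if x: "x \<in> pts X" "x' \<in> pts X" and fin: "edist X x x' < \<infinity>" for x x'
  proof -
    have P: "f x \<in> pts Y" "f x' \<in> pts Y" "f' x \<in> pts Y" "f' x' \<in> pts Y"
      using f_pts f' x by auto
    have "edist Y (f' x) (f' x') \<le> edist Y (f' x) (f x) + edist Y (f x) (f' x')"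
      using Y P unfolding extended_metric_space_def by blast
    also have "\<dots> \<le> edist Y (f' x) (f x) + (edist Y (f x) (f x') + edist Y (f x') (f' x'))"
      using Y P unfolding extended_metric_space_def by (intro add_left_mono) blast
    also have "edist Y (f' x) (f x) = edist Y (f x) (f' x)"
      using Y P unfolding extended_metric_space_def by blast
    also have "edist Y (f x) (f' x) + (edist Y (f x) (f x') + edist Y (f x') (f' x'))
        \<le> ennreal c + ((ennreal a * edist X x x' + ennreal b) + ennreal c)"
      by (intro add_mono c lip x fin)
    also have "\<dots> = ennreal a * edist X x x' + (ennreal b + ennreal c + ennreal c)"
      by (simp add: ac_simps)
    also have "ennreal b + ennreal c + ennreal c = ennreal (b + 2 * c)"
      using ab c by (simp flip: ennreal_plus)
    finally show ?thesis .
  qed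
  moreover have "b + 2 * c \<ge> 0" using ab c by simp
  ultimately show ?thesis
    unfolding coarsely_lipschitz_def using ab(1) f' by blast
qed

section \<open>Rips graphs\<close>

definition rips :: "'a emspace \<Rightarrow> nat \<Rightarrow> ('a \<times> 'a) set" where
  "rips X n = {(x, y). x \<in> pts X \<and> y \<in> pts X \<and> edist X x y \<le> of_nat n}"

lemma graph_rips:
  assumes "extended_metric_space X"
  shows "graph (pts X) (rips X n)"
  using assms by (auto simp: graph_def rips_def sym_def extended_metric_space_def)

lemma edist_le_rips_walk:
  assumes X: "extended_metric_space X" and "(x, y) \<in> rips X n ^^ m" "x \<in> pts X"
  shows "y \<in> pts X \<and> edist X x y \<le> of_nat n * of_nat m"
  using assms(2)
proof (induction m arbitrary: y)
  case 0
  then show ?case using X assms(3) by (auto simp: extended_metric_space_def)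
next
  case (Suc m)
  then obtain z where z: "(x, z) \<in> rips X n ^^ m" "(z, y) \<in> rips X n" by auto
  then have P: "z \<in> pts X" "y \<in> pts X" "edist X x z \<le> of_nat n * of_nat m" "edist X z y \<le> of_nat n"
    using Suc.IH[OF z(1)] by (auto simp: rips_def)
  have "edist X x y \<le> edist X x z + edist X z y"
    using X P assms(3) unfolding extended_metric_space_def by blast
  also have "\<dots> \<le> of_nat n * of_nat m + of_nat n" using P by (intro add_mono)
  finally show ?case using P by (simp add: distrib_left add.commute)
qed

text \<open>The identity from the Rips graph back to \<open>X\<close> is \<open>n\<close>-Lipschitz
  because edges have length at most \<open>n\<close>. So the identity is a quasi-isometry once it is
  coarsely Lipschitz in the other direction.\<close>

lemma quasigeodesic_if_rips:
  assumes X: "extended_metric_space X"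
    and lip: "coarsely_lipschitz X (graph_space (pts X) (rips X n)) id"
  shows "quasigeodesic X"
proof -
  let ?G = "graph_space (pts X) (rips X n)"
  note G = extended_metric_space_graph_space[OF graph_rips[OF X, of n]]
  have "edist X x y \<le> ennreal (real n) * edist ?G x y + ennreal 0"
    if x: "x \<in> pts ?G" "y \<in> pts ?G" "edist ?G x y < \<infinity>" for x y
  proof -
    obtain m where m: "(x, y) \<in> rips X n ^^ m" "edist ?G x y = of_nat m"
      using INF_of_nat_attained[of "{m. (x, y) \<in> rips X n ^^ m}"] x(3)
      by (auto simp: graph_space_def)
    have "x \<in> pts X" using x(1) by (simp add: graph_space_def)
    then have "edist X x y \<le> of_nat n * of_nat m"
      using edist_le_rips_walk[OF X m(1)] by blast
    then show ?thesis by (simp add: m(2) ennreal_of_nat_eq_real_of_nat)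
  qed
  then have "coarsely_lipschitz ?G X id"
    unfolding coarsely_lipschitz_def
    by (intro conjI exI[of _ "real n"] exI[of _ "0::real"]) (auto simp: graph_space_def)
  moreover have "close_maps X X (id \<circ> id) id" "close_maps ?G ?G (id \<circ> id) id"
    using close_maps_refl[OF X, of id X] close_maps_refl[OF G, of id ?G] by auto
  ultimately have "quasi_isometry X ?G id"
    unfolding quasi_isometry_def using lip by blast
  then show ?thesis
    unfolding quasigeodesic_def using X graph_rips[OF X] by blast
qed

section \<open>Weighted chain metrics\<close>

text \<open>A step may be charged for any upper bound \<open>k\<close> of its length, not only for the least one.\<close>

inductive chain :: "'a emspace \<Rightarrow> (nat \<Rightarrow> nat) \<Rightarrow> nat \<Rightarrow> 'a \<Rightarrow> 'a \<Rightarrow> bool" for X w where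
  chain_refl: "x \<in> pts X \<Longrightarrow> chain X w 0 x x"
| chain_step: "chain X w c x y \<Longrightarrow> z \<in> pts X \<Longrightarrow> edist X y z \<le> of_nat k \<Longrightarrow>
    chain X w (c + w k) x z"

definition chain_space :: "'a emspace \<Rightarrow> (nat \<Rightarrow> nat) \<Rightarrow> 'a emspace" where
  "chain_space X w =
    \<lparr>pts = pts X, edist = (\<lambda>x y. INF c\<in>{c. chain X w c x y}. (of_nat c :: ennreal))\<rparr>"

lemma pts_chain_space [simp]: "pts (chain_space X w) = pts X"
  by (simp add: chain_space_def)

lemma edist_chain_space_le: "chain X w c x y \<Longrightarrow> edist (chain_space X w) x y \<le> of_nat c"
  unfolding chain_space_def by (auto intro: INF_lower)

lemma edist_chain_space_attained:
  assumes "edist (chain_space X w) x y < \<infinity>"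
  obtains c where "chain X w c x y" "edist (chain_space X w) x y = of_nat c"
  using INF_of_nat_attained[of "{c. chain X w c x y}"] assms by (auto simp: chain_space_def)

lemma chain_pts: "chain X w c x y \<Longrightarrow> x \<in> pts X \<and> y \<in> pts X"
  by (induction rule: chain.induct) auto

lemma chain_trans:
  assumes "chain X w c x y" "chain X w c' y z"
  shows "chain X w (c + c') x z"
  using assms(2,1)
proof (induction rule: chain.induct)
  case (chain_step c' y z z' k)
  then show ?case using chain.chain_step[of X w "c + c'" x z z' k] by (simp add: add.assoc)
qed simp

lemma chain_single:
  assumes "x \<in> pts X" "y \<in> pts X" "edist X x y \<le> of_nat k"
  shows "chain X w (w k) x y"
  using chain_step[OF chain_refl[OF assms(1)] assms(2,3), of w] by simp

text \<open>If every step is charged for some \<open>k \<le> n\<close>, the chain is a walk in the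
  Rips graph, and its length is at most its cost as each weight is at least 1. Otherwise a single
  step charged for some \<open>k > n\<close> already costs \<open>w k\<close>.\<close>

lemma chain_rips_or_heavy:
  assumes w: "\<And>k. 1 \<le> w k" and "chain X w c x y"
  shows "(\<exists>m\<le>c. (x, y) \<in> rips X n ^^ m) \<or> (\<exists>k>n. w k \<le> c)"
  using assms(2)
proof (induction rule: chain.induct)
  case (chain_refl x)
  then show ?case by auto
next
  case (chain_step c x y z k)
  show ?case
  proof (cases "k \<le> n")
    case True
    then have "edist X y z \<le> of_nat n"
      using chain_step.hyps(3) by (metis of_nat_mono order_trans)
    then have "(y, z) \<in> rips X n"
      using chain_step.hyps by (auto simp: rips_def dest: chain_pts)
    moreover have "Suc m \<le> c + w k" if "m \<le> c" for m using that w[of k] by simp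
    ultimately show ?thesis
      using chain_step.IH by (meson relpow_Suc_I trans_le_add1)
  next
    case False
    then show ?thesis by (auto intro!: disjI2 exI[of _ k])
  qed
qed

text \<open>\<open>w_pos\<close> lets the cost of a chain bound its number of steps;
  \<open>w_ge\<close> lets it bound the distance between its ends.\<close>

locale weighted =
  fixes X :: "'a emspace" and w :: "nat \<Rightarrow> nat"
  assumes X: "extended_metric_space X" and w_pos: "1 \<le> w k" and w_ge: "k \<le> w k"
begin

abbreviation Xw where "Xw \<equiv> chain_space X w"

lemma chain_sym: "chain X w c x y \<Longrightarrow> chain X w c y x"
proof (induction rule: chain.induct)
  case (chain_step c x y z k)
  have "y \<in> pts X" using chain_pts[OF chain_step.hyps(1)] by blast
  then have "chain X w (w k) z y"
    using chain_step X by (intro chain_single) (auto simp: extended_metric_space_def)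
  from chain_trans[OF this chain_step.IH] show ?case by (simp add: add.commute)
qed (rule chain_refl)

lemma edist_le_chain: "chain X w c x y \<Longrightarrow> edist X x y \<le> of_nat c"
proof (induction rule: chain.induct)
  case (chain_refl x)
  then show ?case using X by (auto simp: extended_metric_space_def)
next
  case (chain_step c x y z k)
  have "edist X x z \<le> edist X x y + edist X y z"
    using X chain_step.hyps(2) chain_pts[OF chain_step.hyps(1)]
    unfolding extended_metric_space_def by blast
  also have "\<dots> \<le> of_nat c + of_nat (w k)"
    using chain_step w_ge by (meson add_mono of_nat_mono order_trans)
  finally show ?case by simp
qed

lemma edist_le_chain_space: "edist X x y \<le> edist Xw x y"
  unfolding chain_space_def by (auto intro!: INF_greatest edist_le_chain)

lemma extended_metric_space_chain_space: "extended_metric_space Xw"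
proof -
  have "edist Xw x y = 0 \<longleftrightarrow> x = y" if P: "x \<in> pts X" "y \<in> pts X" for x y
  proof
    assume "edist Xw x y = 0"
    then have "edist X x y = 0" using edist_le_chain_space[of x y] by simp
    then show "x = y" using X P by (simp add: extended_metric_space_def)
  next
    assume "x = y"
    then show "edist Xw x y = 0"
      using edist_chain_space_le[OF chain_refl[OF P(1)], of w] by simp
  qed
  moreover have "edist Xw x y = edist Xw y x" for x y
    unfolding chain_space_def by (auto intro!: INF_cong chain_sym)
  moreover have "edist Xw x z \<le> edist Xw x y + edist Xw y z" for x y z
  proof (cases "edist Xw x y < \<infinity> \<and> edist Xw y z < \<infinity>")
    case True
    then obtain c c' where "chain X w c x y" "edist Xw x y = of_nat c"
      "chain X w c' y z" "edist Xw y z = of_nat c'"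
      by (metis edist_chain_space_attained)
    then show ?thesis using edist_chain_space_le[OF chain_trans] by fastforce
  next
    case False
    then have "edist Xw x y + edist Xw y z = top" by (auto simp: less_top[symmetric])
    then show ?thesis by (simp only: top_greatest)
  qed
  ultimately show ?thesis unfolding extended_metric_space_def pts_chain_space by blast
qed

lemma coarsely_lipschitz_id_chain_space: "coarsely_lipschitz Xw X id"
  unfolding coarsely_lipschitz_def
  by (intro conjI exI[of _ "1::real"] exI[of _ "0::real"]) (auto intro: edist_le_chain_space)

section \<open>Lifting closeness and maps to the weighted space\<close>

text \<open>Points at distance at most \<open>k\<close> are joined by one step of cost
  \<open>w k\<close>. A uniform bound thus stays uniform, however fast \<open>w\<close>
  grows.\<close>

lemma close_maps_chain_space:
  assumes f: "f \<in> pts A \<rightarrow> pts X" "g \<in> pts A \<rightarrow> pts X" and "close_maps A X f g"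
  shows "close_maps A Xw f g"
proof -
  obtain c where c: "\<And>x. x \<in> pts A \<Longrightarrow> edist X (f x) (g x) \<le> ennreal c"
    using assms(3) unfolding close_maps_iff by blast
  obtain k where k: "ennreal c \<le> of_nat k" by (rule ennreal_le_of_nat)
  have "edist Xw (f x) (g x) \<le> ennreal (real (w k))" if x: "x \<in> pts A" for x
  proof -
    have "chain X w (w k) (f x) (g x)"
      using f x order_trans[OF c[OF x] k] by (intro chain_single) auto
    then show ?thesis
      using edist_chain_space_le by (simp add: ennreal_of_nat_eq_real_of_nat)
  qed
  then show ?thesis unfolding close_maps_iff by (intro exI[of _ "real (w k)"]) auto
qed

text \<open>The images of adjacent vertices are at most \<open>a + b\<close> apart, so one
  \<open>k\<close> serves all edges. A walk of length \<open>n\<close> becomes a chain of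
  \<open>n\<close> steps of weight \<open>w k\<close>, which gives the Lipschitz constant
  \<open>w k\<close>.\<close>

lemma coarsely_lipschitz_graph_chain_space:
  assumes G: "graph V E" and f: "coarsely_lipschitz (graph_space V E) X f"
  shows "coarsely_lipschitz (graph_space V E) Xw f"
proof -
  let ?G = "graph_space V E"
  obtain a b where ab: "a \<ge> 0" "b \<ge> 0" and pts: "f \<in> V \<rightarrow> pts X"
    and lip: "\<And>x y. x \<in> V \<Longrightarrow> y \<in> V \<Longrightarrow> edist ?G x y < \<infinity> \<Longrightarrow>
      edist X (f x) (f y) \<le> ennreal a * edist ?G x y + ennreal b"
    using f unfolding coarsely_lipschitz_def by (auto simp: graph_space_def)
  obtain k where k: "ennreal (a + b) \<le> of_nat k" by (rule ennreal_le_of_nat)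
  have step: "edist X (f x) (f y) \<le> of_nat k" if xy: "(x, y) \<in> E" for x y
  proof -
    have V: "x \<in> V" "y \<in> V" using G xy by (auto simp: graph_def)
    have "(x, y) \<in> E ^^ 1" using xy by simp
    then have "edist ?G x y \<le> of_nat 1"
      unfolding graph_space_def emspace.simps by (intro INF_lower) blast
    then have le: "edist ?G x y \<le> 1" by simp
    then have "edist ?G x y < \<infinity>" by (simp add: order_le_less_trans)
    then have "edist X (f x) (f y) \<le> ennreal a * edist ?G x y + ennreal b" by (intro lip V)
    also have "\<dots> \<le> ennreal a * 1 + ennreal b"
      using le by (intro add_right_mono mult_left_mono) auto
    also have "\<dots> = ennreal (a + b)" using ab by simp
    finally show ?thesis using k by (rule order_trans)
  qed
  have walk: "chain X w (n * w k) (f x) (f y)" if "(x, y) \<in> E ^^ n" "x \<in> V" for n x y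
    using that(1)
  proof (induction n arbitrary: y)
    case 0
    then show ?case using pts that(2) by (auto intro: chain_refl)
  next
    case (Suc n)
    then obtain z where z: "(x, z) \<in> E ^^ n" "(z, y) \<in> E" by auto
    moreover have "f y \<in> pts X" using G pts z by (auto simp: graph_def)
    ultimately show ?case
      using chain_step[OF Suc.IH[OF z(1)] _ step[OF z(2)]] by (simp add: add.commute)
  qed
  have "edist Xw (f x) (f y) \<le> ennreal (real (w k)) * edist ?G x y + ennreal 0"
    if xy: "x \<in> V" "edist ?G x y < \<infinity>" for x y
  proof -
    obtain n where "(x, y) \<in> E ^^ n" and n: "edist ?G x y = of_nat n"
      using INF_of_nat_attained[of "{m. (x, y) \<in> E ^^ m}"] xy(2) by (auto simp: graph_space_def)
    then have "edist Xw (f x) (f y) \<le> of_nat (n * w k)"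
      by (intro edist_chain_space_le walk xy(1))
    then show ?thesis by (simp add: n ennreal_of_nat_eq_real_of_nat ennreal_mult mult.commute)
  qed
  then show ?thesis
    unfolding coarsely_lipschitz_def using pts
    by (intro conjI exI[of _ "real (w k)"] exI[of _ "0::real"]) (auto simp: graph_space_def)
qed

text \<open>Going to the graph and back changes \<open>f\<close> only to the close map
  \<open>f \<circ> (r \<circ> q)\<close>. That map factors through the graph, and closeness in
  \<open>Xw\<close> carries its bound over to \<open>f\<close>.\<close>

lemma coarsely_lipschitz_quasigeodesic_chain_space:
  fixes A :: "'b emspace"
  assumes "quasigeodesic A" and f: "coarsely_lipschitz A X f"
  shows "coarsely_lipschitz A Xw f"
proof -
  obtain V :: "'b set" and E q r where A: "extended_metric_space A" and G: "graph V E"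
    and q: "coarsely_lipschitz A (graph_space V E) q"
    and r: "coarsely_lipschitz (graph_space V E) A r" and rq: "close_maps A A (r \<circ> q) id"
    using assms(1) unfolding quasigeodesic_def quasi_isometry_def by blast
  note rq_lip = coarsely_lipschitz_comp[OF q r]
  have "coarsely_lipschitz (graph_space V E) Xw (f \<circ> r)"
    by (intro coarsely_lipschitz_graph_chain_space G coarsely_lipschitz_comp[OF r f])
  then have lip: "coarsely_lipschitz A Xw (f \<circ> (r \<circ> q))"
    using coarsely_lipschitz_comp[OF q] by (metis comp_assoc)
  have pts: "f \<in> pts A \<rightarrow> pts X" "f \<circ> (r \<circ> q) \<in> pts A \<rightarrow> pts X"
    using f coarsely_lipschitz_comp[OF rq_lip f] by (simp_all add: coarsely_lipschitz_def)
  have "close_maps A X (f \<circ> (r \<circ> q)) f"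
    using close_maps_comp[OF X rq_lip coarsely_lipschitz_id f rq] by simp
  then have "close_maps A Xw (f \<circ> (r \<circ> q)) f" by (intro close_maps_chain_space pts)
  then show ?thesis
    using coarsely_lipschitz_close[OF extended_metric_space_chain_space lip] pts(1) by simp
qed

section \<open>The universal property tested on the weighted space\<close>

lemma coarsely_lipschitz_chain_space_colimit:
  assumes D: "diagram J CLip D D'" and qg: "\<And>j. j \<in> Ob J \<Longrightarrow> quasigeodesic (D j)"
    and colim: "is_colimit J CLip D D' X \<iota>"
  shows "coarsely_lipschitz X Xw id"
proof -
  interpret diagram J CLip D D' by (rule D)
  note Xw = extended_metric_space_chain_space
  have cocone: "is_cocone J CLip D D' X \<iota>" using colim by (simp add: is_colimit_def)
  have \<iota>_hom: "\<iota> j \<in> hom CLip (D j) X" if "j \<in> Ob J" for j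
    using cocone that by (simp add: is_cocone_def)
  have D_ems: "extended_metric_space (D j)" if "j \<in> Ob J" for j
    using \<iota>_hom[OF that] by (simp add: hom_CLip)
  obtain i where i: "\<And>j. j \<in> Ob J \<Longrightarrow> coarsely_lipschitz (D j) X (i j)"
    and \<iota>: "\<And>j. j \<in> Ob J \<Longrightarrow> \<iota> j = (D j, X, closeness (D j) X `` {i j})"
    using \<iota>_hom unfolding hom_CLip by metis
  have iw: "coarsely_lipschitz (D j) Xw (i j)" if "j \<in> Ob J" for j
    using that by (intro coarsely_lipschitz_quasigeodesic_chain_space qg i)
  \<comment> \<open>The representatives \<open>i j\<close> are kept; only the target changes, and
    with it the closeness class.\<close>
  define \<kappa> where "\<kappa> j = (D j, Xw, closeness (D j) Xw `` {i j})" for j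
  have "is_cocone J CLip D D' Xw \<kappa>"
    unfolding is_cocone_def
  proof (intro conjI ballI)
    show "Xw \<in> Ob CLip" using Xw by (simp add: CLip_def)
    show "\<kappa> j \<in> hom CLip (D j) Xw" if "j \<in> Ob J" for j
      unfolding hom_CLip \<kappa>_def using D_ems Xw iw that by blast
    fix j l u assume jl: "j \<in> Ob J" "l \<in> Ob J" and u: "u \<in> hom J j l"
    obtain v where v: "coarsely_lipschitz (D j) (D l) v"
      and Du: "D' u = (D j, D l, closeness (D j) (D l) `` {v})"
      using map_hom[OF u] unfolding hom_CLip by blast
    have "Comp CLip (\<iota> l) (D' u) = \<iota> j" using cocone jl u by (simp add: is_cocone_def)
    then have "close_maps (D j) X (i l \<circ> v) (i j)"
      using jl closeness_class_eq_iff[OF X coarsely_lipschitz_comp[OF v i[OF jl(2)]] i[OF jl(1)]]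
      by (simp add: \<iota> Du Comp_CLip D_ems X v i)
    then have "close_maps (D j) Xw (i l \<circ> v) (i j)"
      using coarsely_lipschitz_comp[OF v i[OF jl(2)]] i[OF jl(1)]
      by (intro close_maps_chain_space) (auto simp: coarsely_lipschitz_def)
    then show "Comp CLip (\<kappa> l) (D' u) = \<kappa> j"
      using jl closeness_class_eq_iff[OF Xw coarsely_lipschitz_comp[OF v iw[OF jl(2)]] iw[OF jl(1)]]
      by (simp add: \<kappa>_def Du Comp_CLip D_ems Xw v iw)
  qed
  then obtain \<phi> where "\<phi> \<in> hom CLip X Xw" and \<phi>_\<iota>: "\<And>j. j \<in> Ob J \<Longrightarrow> Comp CLip \<phi> (\<iota> j) = \<kappa> j"
    using colim unfolding is_colimit_def by blast
  then obtain h where h: "coarsely_lipschitz X Xw h" and \<phi>: "\<phi> = (X, Xw, closeness X Xw `` {h})"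
    unfolding hom_CLip by blast
  \<comment> \<open>Existence only yields some \<open>h\<close>. To compare it with
    \<open>id\<close>, it is viewed as an endomorphism of \<open>X\<close>, where uniqueness applies
    to the original cocone.\<close>
  have hX: "coarsely_lipschitz X X h"
    using coarsely_lipschitz_comp[OF h coarsely_lipschitz_id_chain_space] by simp
  define \<psi> where "\<psi> = (X, X, closeness X X `` {h})"
  have \<psi>_\<iota>: "Comp CLip \<psi> (\<iota> j) = \<iota> j" if j: "j \<in> Ob J" for j
  proof -
    have hi: "coarsely_lipschitz (D j) Xw (h \<circ> i j)" "coarsely_lipschitz (D j) X (h \<circ> i j)"
      using i[OF j] h hX by (auto intro: coarsely_lipschitz_comp)
    have "close_maps (D j) Xw (h \<circ> i j) (i j)"
      using \<phi>_\<iota>[OF j] j closeness_class_eq_iff[OF Xw hi(1) iw[OF j]]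
      by (simp add: \<phi> \<kappa>_def \<iota> Comp_CLip X Xw i h)
    then have "close_maps (D j) X (id \<circ> (h \<circ> i j)) (id \<circ> i j)"
      by (rule close_maps_comp[OF X hi(1) iw[OF j] coarsely_lipschitz_id_chain_space])
    then show ?thesis
      using j closeness_class_eq_iff[OF X hi(2) i[OF j]] by (simp add: \<psi>_def \<iota> Comp_CLip X i hX)
  qed
  have Id_\<iota>: "Comp CLip (Id CLip X) (\<iota> j) = \<iota> j" if "j \<in> Ob J" for j
    using category.Id_Comp[OF category_CLip \<iota>_hom[OF that]] .
  have "\<psi> \<in> hom CLip X X" "Id CLip X \<in> hom CLip X X"
    unfolding hom_CLip \<psi>_def Id_CLip using X hX coarsely_lipschitz_id by blast+
  then have "\<psi> = Id CLip X"
    using colim cocone \<psi>_\<iota> Id_\<iota> unfolding is_colimit_def by blast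
  then have "close_maps X X h id"
    using closeness_class_eq_iff[OF X hX coarsely_lipschitz_id] by (simp add: \<psi>_def Id_CLip)
  \<comment> \<open>Closeness lifts from \<open>X\<close> to \<open>Xw\<close> before
    \<open>id\<close> is known to be coarsely Lipschitz into \<open>Xw\<close>; it then inherits
    this from \<open>h\<close>.\<close>
  then have "close_maps X Xw h id"
    using hX by (intro close_maps_chain_space) (auto simp: coarsely_lipschitz_def)
  then show ?thesis by (intro coarsely_lipschitz_close[OF Xw h]) auto
qed

end

section \<open>Diagonal choice of the weight\<close>

lemma quasigeodesic_if_chain_spaces:
  fixes X :: "'a emspace"
  assumes X: "extended_metric_space X"
    and lip: "\<And>w. weighted X w \<Longrightarrow> coarsely_lipschitz X (chain_space X w) id"
  shows "quasigeodesic X"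
proof (rule ccontr)
  assume not_qg: "\<not> quasigeodesic X"
  let ?G = "\<lambda>n. graph_space (pts X) (rips X n)"
  \<comment> \<open>Without such a pair, \<open>id\<close> would be coarsely Lipschitz into the
    \<open>n\<close>-th Rips graph with both constants equal to \<open>n\<close>. The distance on
    the right may be infinite.\<close>
  have "\<exists>x y. x \<in> pts X \<and> y \<in> pts X \<and> edist X x y < \<infinity> \<and>
    of_nat n * edist X x y + of_nat n < edist (?G n) x y" for n
  proof (rule ccontr)
    assume "\<nexists>x y. x \<in> pts X \<and> y \<in> pts X \<and> edist X x y < \<infinity> \<and>
      of_nat n * edist X x y + of_nat n < edist (?G n) x y"
    then have "edist (?G n) x y \<le> ennreal (real n) * edist X x y + ennreal (real n)"
      if "x \<in> pts X" "y \<in> pts X" "edist X x y < \<infinity>" for x y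
      using that by (metis not_less ennreal_of_nat_eq_real_of_nat)
    then have "coarsely_lipschitz X (?G n) id"
      unfolding coarsely_lipschitz_def
      by (intro conjI exI[of _ "real n"]) (auto simp: graph_space_def)
    then show False using quasigeodesic_if_rips[OF X] not_qg by blast
  qed
  then obtain p q where pq: "\<And>n. p n \<in> pts X" "\<And>n. q n \<in> pts X"
    and fin: "\<And>n. edist X (p n) (q n) < \<infinity>"
    and far: "\<And>n. of_nat n * edist X (p n) (q n) + of_nat n < edist (?G n) (p n) (q n)"
    by metis
  have "\<exists>B. of_nat n * edist X (p n) (q n) + of_nat n \<le> (of_nat B :: ennreal)" for n
  proof -
    have "of_nat n * edist X (p n) (q n) + of_nat n < (\<infinity> :: ennreal)"
      using fin[of n] by (simp add: ennreal_mult_less_top of_nat_less_top)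
    then obtain c where "of_nat n * edist X (p n) (q n) + of_nat n = ennreal c"
      by (cases "of_nat n * edist X (p n) (q n) + of_nat n") auto
    then show ?thesis using ennreal_le_of_nat by metis
  qed
  then obtain B where B: "\<And>n. of_nat n * edist X (p n) (q n) + of_nat n \<le> (of_nat (B n) :: ennreal)"
    by metis
  \<comment> \<open>The sum makes \<open>w k\<close> dominate all \<open>B n\<close> with
    \<open>n \<le> k\<close> at once; \<open>Suc k\<close> secures the two conditions on
    weights.\<close>
  define w where "w k = Suc k + (\<Sum>n\<le>k. B n)" for k
  have w_B: "B n \<le> w k" if "n < k" for n k
    unfolding w_def using that member_le_sum[of n "{..k}" B] by simp
  interpret weighted X w by unfold_locales (auto simp: X w_def)
  have lower: "of_nat n * edist X (p n) (q n) + of_nat n \<le> edist Xw (p n) (q n)" for n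
  proof -
    have "of_nat n * edist X (p n) (q n) + of_nat n \<le> (of_nat c :: ennreal)"
      if "chain X w c (p n) (q n)" for c
      \<comment> \<open>A Rips walk is too long by \<open>far\<close>; a step charged beyond
        \<open>n\<close> costs at least \<open>B n\<close>.\<close>
      using chain_rips_or_heavy[of w, OF w_pos that, of n]
    proof (elim disjE exE conjE)
      fix m assume "m \<le> c" "(p n, q n) \<in> rips X n ^^ m"
      then have "edist (?G n) (p n) (q n) \<le> of_nat m"
        unfolding graph_space_def emspace.simps by (intro INF_lower) blast
      also have "\<dots> \<le> of_nat c" using \<open>m \<le> c\<close> by simp
      finally show ?thesis using far[of n] by simp
    next
      fix k assume "n < k" "w k \<le> c"
      then have "B n \<le> c" using w_B order_trans by blast
      then show ?thesis using B[of n] by (meson of_nat_mono order_trans)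
    qed
    then show ?thesis unfolding chain_space_def by (auto intro: INF_greatest)
  qed
  have "coarsely_lipschitz X Xw id" by (intro lip weighted_axioms)
  then obtain a b where ab: "a \<ge> 0" "b \<ge> 0" and
    upper: "\<And>n. edist Xw (p n) (q n) \<le> ennreal a * edist X (p n) (q n) + ennreal b"
    unfolding coarsely_lipschitz_def using pq fin by auto
  \<comment> \<open>With \<open>n\<close> above both constants,
    \<open>a * d + b < n * d + n\<close>, contradicting \<open>lower\<close> and
    \<open>upper\<close>.\<close>
  obtain n where n: "max a b < real n" using reals_Archimedean2 by blast
  obtain d where d: "d \<ge> 0" "edist X (p n) (q n) = ennreal d"
    using fin[of n] by (cases "edist X (p n) (q n)") auto
  have "of_nat n * edist X (p n) (q n) + of_nat n \<le> ennreal a * edist X (p n) (q n) + ennreal b"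
    using lower upper by (rule order_trans)
  then have "n * d + n \<le> a * d + b"
    using ab d by (simp add: ennreal_of_nat_eq_real_of_nat flip: ennreal_mult ennreal_plus)
  moreover have "a * d \<le> n * d" using n d by (intro mult_right_mono) auto
  ultimately show False using n by simp
qed

theorem theorem1p3:
  fixes J :: "('j, 'u) category"
    and D :: "'j \<Rightarrow> 'a emspace"
    and D' :: "'u \<Rightarrow> 'a emspace \<times> 'a emspace \<times> ('a \<Rightarrow> 'a) set"
    and X :: "'a emspace"
    and \<iota> :: "'j \<Rightarrow> 'a emspace \<times> 'a emspace \<times> ('a \<Rightarrow> 'a) set"
  assumes "diagram J CLip D D'"
    and "\<And>j. j \<in> Ob J \<Longrightarrow> quasigeodesic (D j)"
    and "is_colimit J CLip D D' X \<iota>"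
  shows "quasigeodesic X"
proof (rule quasigeodesic_if_chain_spaces)
  show "extended_metric_space X"
    using assms(3) by (simp add: is_colimit_def is_cocone_def CLip_def)
  show "coarsely_lipschitz X (chain_space X w) id" if "weighted X w" for w
    using weighted.coarsely_lipschitz_chain_space_colimit[OF that assms] .
qed

end
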